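(* Let $\mathcal{F}=\{\mathbb{X};\,f_1,\dots,f_N\}$ be an iterated function system on a complete metric space $\mathbb{X}$, let $A$ be a point-fibred attractor of $\mathcal{F}$ with coding map $\pi:\mathbb{I}_+\to A$, and let $\theta\in\mathbb{I}_+$ be disjunctive. Then $\pi(\theta)\in A^\circ$ if and only if $A^\circ\neq\varnothing$.
   Context: An iterated function system (IFS) $\mathcal{F}=\{\mathbb{X};\,f_1,\dots,f_N\}$ is a complete metric space $(\mathbb{X},d_{\mathbb{X}})$ together with finitely many homeomorphisms $f_n:\mathbb{X}\to\mathbb{X}$ of $\mathbb{X}$ onto itself. $H$ is the set of nonempty compact subsets of $\mathbb{X}$ with the Hausdorff metric. For $S\subset\mathbb{X}$, $F(S)=\bigcup_{n=1}^N f_n(S)$, and $F^k$ is the $k$-fold iterate of $F$. An attractor of $\mathcal{F}$ is a set $A\in H$ with $F(A)=A$ for which there is an open set $U\supset A$ such that $F^k(C)\to A$ in the Hausdorff metric for every $C\in H$ with $C\subset U$. The union of all such open sets $U$ is the basin $B(A)$ of $A$ (the defining property also holds with $U=B(A)$). $I_+=\{1,\dots,N\}$ and $\mathbb{I}_+=I_+^{\infty}$ (infinite words). For $\iota\in\mathbb{I}_+$, $f_{\iota|k}=f_{\iota_1}\circ\cdots\circ f_{\iota_k}$. The attractor $A$ is point-fibred if for every $\iota\in\mathbb{I}_+$ the limit $\lim_{k\to\infty}f_{\iota|k}(C)$ exists in the Hausdorff metric for all $C\in H$ with $C\subset B(A)$, is a singleton subset of $A$, and is independent of $C$. The coding map $\pi:\mathbb{I}_+\to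 A$ is $\pi(\iota)=\lim_{k\to\infty}f_{\iota|k}(b)$, independent of $b\in B(A)$. A word $\theta\in\mathbb{I}_+$ is disjunctive if every finite word in the alphabet $I_+$ is a subword (block of consecutive letters) of $\theta$. $A^\circ$ denotes the interior of $A$ in $\mathbb{X}$. *)

theory Defs
  imports "HOL-Analysis.Analysis"
begin

text \<open>The complete metric space is a type of class \<^class>\<open>complete_space\<close>. A system of
  \<open>N\<close> maps is a function \<open>f :: nat \<Rightarrow> 'a \<Rightarrow> 'a\<close> of which only the values at \<open>1, \<dots>, N\<close>
  matter.\<close>

definition ifs :: "nat \<Rightarrow> (nat \<Rightarrow> 'a::complete_space \<Rightarrow> 'a) \<Rightarrow> bool" where
  "ifs N f \<longleftrightarrow> 1 \<le> N \<and> (\<forall>n\<in>{1..N}. \<exists>g. homeomorphism UNIV UNIV (f n) g)"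

definition hyperspace :: "'a::metric_space set set" where
  "hyperspace = {C. C \<noteq> {} \<and> compact C}"

text \<open>This is the Hausdorff metric only on \<open>hyperspace\<close>: on empty or unbounded sets
  \<^const>\<open>infdist\<close> and the real supremum take default values.\<close>

definition hausdist :: "'a::metric_space set \<Rightarrow> 'a set \<Rightarrow> real" where
  "hausdist S T = max (SUP x\<in>S. infdist x T) (SUP y\<in>T. infdist y S)"

definition hausdorff_tendsto :: "(nat \<Rightarrow> 'a::metric_space set) \<Rightarrow> 'a set \<Rightarrow> bool" where
  "hausdorff_tendsto C L \<longleftrightarrow> (\<lambda>k. hausdist (C k) L) \<longlonglongrightarrow> 0"

definition hutchinson :: "nat \<Rightarrow> (nat \<Rightarrow> 'a \<Rightarrow> 'a) \<Rightarrow> 'a set \<Rightarrow> 'a set" where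
  "hutchinson N f S = (\<Union>n\<in>{1..N}. f n ` S)"

definition attracting_nhd ::
    "nat \<Rightarrow> (nat \<Rightarrow> 'a::complete_space \<Rightarrow> 'a) \<Rightarrow> 'a set \<Rightarrow> 'a set \<Rightarrow> bool" where
  "attracting_nhd N f A U \<longleftrightarrow> open U \<and> A \<subseteq> U \<and>
     (\<forall>C\<in>hyperspace. C \<subseteq> U \<longrightarrow> hausdorff_tendsto (\<lambda>k. (hutchinson N f ^^ k) C) A)"

definition attractor :: "nat \<Rightarrow> (nat \<Rightarrow> 'a::complete_space \<Rightarrow> 'a) \<Rightarrow> 'a set \<Rightarrow> bool" where
  "attractor N f A \<longleftrightarrow>
     A \<in> hyperspace \<and> hutchinson N f A = A \<and> (\<exists>U. attracting_nhd N f A U)"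

definition basin :: "nat \<Rightarrow> (nat \<Rightarrow> 'a::complete_space \<Rightarrow> 'a) \<Rightarrow> 'a set \<Rightarrow> 'a set" where
  "basin N f A = \<Union>{U. attracting_nhd N f A U}"

text \<open>Infinite words are indexed from \<open>0\<close>, so the first letter of \<open>\<iota>\<close> is \<open>\<iota> 0\<close>.\<close>

definition inf_words :: "nat \<Rightarrow> (nat \<Rightarrow> nat) set" where
  "inf_words N = {\<iota>. \<forall>k. \<iota> k \<in> {1..N}}"

text \<open>\<open>word_map f \<iota> k\<close> is \<open>f (\<iota> 0) \<circ> \<dots> \<circ> f (\<iota> (k - 1))\<close>: the last letter is applied first.\<close>

primrec word_map :: "(nat \<Rightarrow> 'a \<Rightarrow> 'a) \<Rightarrow> (nat \<Rightarrow> nat) \<Rightarrow> nat \<Rightarrow> 'a \<Rightarrow> 'a" where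
  "word_map f \<iota> 0 = id"
| "word_map f \<iota> (Suc k) = word_map f \<iota> k \<circ> f (\<iota> k)"

text \<open>The point \<open>x\<close> is chosen before \<open>C\<close>: the limit does not depend on \<open>C\<close>.\<close>

definition point_fibred :: "nat \<Rightarrow> (nat \<Rightarrow> 'a::complete_space \<Rightarrow> 'a) \<Rightarrow> 'a set \<Rightarrow> bool" where
  "point_fibred N f A \<longleftrightarrow>
     (\<forall>\<iota>\<in>inf_words N. \<exists>x\<in>A. \<forall>C\<in>hyperspace. C \<subseteq> basin N f A \<longrightarrow>
        hausdorff_tendsto (\<lambda>k. word_map f \<iota> k ` C) {x})"

text \<open>The common limit over all \<open>b\<close> in the basin; it exists and is unique when \<open>A\<close> is a
  point-fibred attractor.\<close>

definition coding_map ::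
    "nat \<Rightarrow> (nat \<Rightarrow> 'a::complete_space \<Rightarrow> 'a) \<Rightarrow> 'a set \<Rightarrow> (nat \<Rightarrow> nat) \<Rightarrow> 'a" where
  "coding_map N f A \<iota> = (THE x. \<forall>b\<in>basin N f A. (\<lambda>k. word_map f \<iota> k b) \<longlonglongrightarrow> x)"

definition disjunctive :: "nat \<Rightarrow> (nat \<Rightarrow> nat) \<Rightarrow> bool" where
  "disjunctive N \<theta> \<longleftrightarrow>
     (\<forall>w\<in>lists {1..N}. \<exists>m. map \<theta> [m..<m + length w] = w)"

end

(* A point p of the interior of A has an address \<sigma>, and the images of A under the initial words of
   \<sigma> shrink to p, so some word w satisfies f_w(A) \<subseteq> interior A. As \<theta> is disjunctive, w occurs in
   \<theta> after some prefix u; then \<pi>(\<theta>) lies in f_u(f_w(A)) \<subseteq> f_u(interior A), which is an open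
   subset of A because f_u is a homeomorphism mapping A into itself. *)

theory Submission
  imports Defs
begin

lemma word_map_cong:
  assumes "\<And>i. i < k \<Longrightarrow> \<iota> i = \<kappa> i"
  shows "word_map f \<iota> k = word_map f \<kappa> k"
  using assms by (induction k) auto

lemma word_map_add: "word_map f \<iota> (m + k) = word_map f \<iota> m \<circ> word_map f (\<lambda>i. \<iota> (m + i)) k"
  by (induction k) (simp_all add: comp_assoc)

text \<open>Serves twice: continuity makes images of compact sets compact, and openness of the map
  carries \<open>interior A\<close> to an open set.\<close>

lemma word_map_homeomorphism:
  assumes "ifs N f" "\<iota> \<in> inf_words N"
  shows "\<exists>g. homeomorphism UNIV UNIV (word_map f \<iota> k) g"
proof (induction k)
  case 0
  show ?case by (auto simp: id_def intro: homeomorphism_ident)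
next
  case (Suc k)
  have "\<exists>g. homeomorphism UNIV UNIV (f (\<iota> k)) g"
    using assms by (auto simp: ifs_def inf_words_def)
  with Suc show ?case
    by (metis word_map.simps(2) homeomorphism_compose)
qed

lemma word_map_image_subset:
  assumes "hutchinson N f A = A" "\<iota> \<in> inf_words N"
  shows "word_map f \<iota> k ` A \<subseteq> A"
proof (induction k)
  case 0
  show ?case by simp
next
  case (Suc k)
  have "f (\<iota> k) ` A \<subseteq> A"
    using assms by (fastforce simp: inf_words_def hutchinson_def)
  with Suc show ?case
    by (fastforce simp: image_comp[symmetric])
qed

text \<open>Cut the longer word after \<open>j\<close> letters: the tail acts first and maps
  \<open>A\<close> into itself.\<close>

lemma word_map_image_antimono:
  assumes "hutchinson N f A = A" "\<iota> \<in> inf_words N" "j \<le> k"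
  shows "word_map f \<iota> k ` A \<subseteq> word_map f \<iota> j ` A"
proof -
  have "(\<lambda>i. \<iota> (j + i)) \<in> inf_words N"
    using assms(2) by (simp add: inf_words_def)
  then have "word_map f (\<lambda>i. \<iota> (j + i)) (k - j) ` A \<subseteq> A"
    by (rule word_map_image_subset[OF assms(1)])
  then show ?thesis
    using word_map_add[of f \<iota> j "k - j"] assms(3) by auto
qed

text \<open>Since \<open>A\<close> is covered by its images, each of its points has a preimage in
  \<open>A\<close> under some map. Choosing such preimages repeatedly, starting at \<open>p\<close>,
  spells out an infinite word.\<close>

lemma exists_address:
  assumes "hutchinson N f A = A" "p \<in> A"
  shows "\<exists>\<sigma>\<in>inf_words N. \<forall>k. p \<in> word_map f \<sigma> k ` A"
proof -
  have "\<forall>x\<in>A. \<exists>n\<in>{1..N}. \<exists>y\<in>A. x = f n y"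
    using assms(1) by (force simp: hutchinson_def)
  then obtain c t where c: "\<And>x. x \<in> A \<Longrightarrow> c x \<in> {1..N}"
    and t: "\<And>x. x \<in> A \<Longrightarrow> t x \<in> A" and eq: "\<And>x. x \<in> A \<Longrightarrow> f (c x) (t x) = x"
    by metis
  \<comment> \<open>\<open>t\<close> picks the preimage and \<open>c\<close> the letter of the map
    leading back from it, so \<sigma> records the letters along the backward orbit of
    \<open>p\<close>.\<close>
  define \<sigma> where "\<sigma> k = c ((t ^^ k) p)" for k
  have orbit: "(t ^^ k) p \<in> A" for k
    by (induction k) (use assms(2) t in auto)
  have "word_map f \<sigma> k ((t ^^ k) p) = p" for k
    by (induction k) (use eq[OF orbit] in \<open>auto simp: \<sigma>_def\<close>)
  then have "p \<in> word_map f \<sigma> k ` A" for k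
    using orbit by (metis image_eqI)
  moreover have "\<sigma> \<in> inf_words N"
    using c[OF orbit] by (simp add: \<sigma>_def inf_words_def)
  ultimately show ?thesis by blast
qed

text \<open>Only the first supremum in \<open>hausdist\<close> matters here. Boundedness of
  \<open>S\<close> ensures that this real supremum is a genuine upper bound.\<close>

lemma dist_le_hausdist_singleton:
  assumes "bounded S" "y \<in> S"
  shows "dist y x \<le> hausdist S {x}"
proof -
  have "bdd_above ((\<lambda>y. infdist y {x}) ` S)"
    using assms(1) unfolding bounded_any_center[of S x]
    by (auto simp: dist_commute bdd_above_def)
  then have "infdist y {x} \<le> (SUP y\<in>S. infdist y {x})"
    by (rule cSUP_upper[OF assms(2)])
  then show ?thesis
    by (simp add: hausdist_def)
qed

lemma hausdorff_tendsto_singletonD: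
  assumes "hausdorff_tendsto C {x}" "\<And>k. bounded (C k)" "0 < e"
  shows "\<forall>\<^sub>F k in sequentially. C k \<subseteq> ball x e"
proof -
  have "\<forall>\<^sub>F k in sequentially. hausdist (C k) {x} < e"
    using assms(1,3) by (simp add: hausdorff_tendsto_def order_tendsto_iff)
  then show ?thesis
  proof eventually_elim
    case (elim k)
    then show ?case
      using dist_le_hausdist_singleton[OF assms(2), of _ k x] by (force simp: dist_commute)
  qed
qed

lemma attractor_subset_basin: "attractor N f A \<Longrightarrow> A \<subseteq> basin N f A"
  by (fastforce simp: attractor_def attracting_nhd_def basin_def)

text \<open>A point of the basin is what makes the limit unique; over an empty basin the condition
  under \<open>THE\<close> would hold vacuously for every point.\<close>

lemma coding_map_eqI:
  assumes "basin N f A \<noteq> {}" "\<And>b. b \<in> basin N f A \<Longrightarrow> (\<lambda>k. word_map f \<iota> k b) \<longlonglongrightarrow> x"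
  shows "coding_map N f A \<iota> = x"
  unfolding coding_map_def using assms by (blast intro: the_equality LIMSEQ_unique)

text \<open>Point-fibredness provides a common Hausdorff limit \<open>{x}\<close>. Testing it on
  singletons \<open>{b}\<close> identifies \<open>x\<close> with the coding map, and testing it on
  \<open>A\<close> itself gives the claim.\<close>

lemma word_map_images_shrink:
  assumes "ifs N f" "attractor N f A" "point_fibred N f A" "\<iota> \<in> inf_words N" "0 < e"
  shows "\<forall>\<^sub>F k in sequentially. word_map f \<iota> k ` A \<subseteq> ball (coding_map N f A \<iota>) e"
proof -
  obtain x where x: "\<And>C. \<lbrakk>C \<in> hyperspace; C \<subseteq> basin N f A\<rbrakk>
      \<Longrightarrow> hausdorff_tendsto (\<lambda>k. word_map f \<iota> k ` C) {x}"
    using assms(3,4) unfolding point_fibred_def by blast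
  have A: "A \<in> hyperspace"
    using assms(2) by (simp add: attractor_def)
  have shrink: "\<forall>\<^sub>F k in sequentially. word_map f \<iota> k ` C \<subseteq> ball x e"
    if "C \<in> hyperspace" "C \<subseteq> basin N f A" "0 < e" for C e
  proof (rule hausdorff_tendsto_singletonD[OF x[OF that(1,2)] _ that(3)])
    fix k
    have "continuous_on C (word_map f \<iota> k)"
      by (meson UNIV_I continuous_on_subset homeomorphism_cont1 subsetI
          word_map_homeomorphism[OF assms(1,4)])
    then show "bounded (word_map f \<iota> k ` C)"
      using that(1) by (auto simp: hyperspace_def intro: compact_imp_bounded compact_continuous_image)
  qed
  have "(\<lambda>k. word_map f \<iota> k b) \<longlonglongrightarrow> x" if "b \<in> basin N f A" for b
  proof (rule tendstoI)
    fix e :: real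
    assume "0 < e"
    then show "\<forall>\<^sub>F k in sequentially. dist (word_map f \<iota> k b) x < e"
      using shrink[of "{b}" e] that by (simp add: hyperspace_def dist_commute)
  qed
  then have "coding_map N f A \<iota> = x"
    using A attractor_subset_basin[OF assms(2)]
    by (intro coding_map_eqI) (auto simp: hyperspace_def)
  then show ?thesis
    using shrink[OF A attractor_subset_basin[OF assms(2)] assms(5)] by simp
qed

text \<open>The images of \<open>A\<close> are closed, decrease with the length of the word and
  shrink to the coding point, which therefore lies in the closure of each of them.\<close>

lemma coding_map_in_word_map_image:
  assumes "ifs N f" "attractor N f A" "point_fibred N f A" "\<iota> \<in> inf_words N"
  shows "coding_map N f A \<iota> \<in> word_map f \<iota> k ` A"
proof -
  have A: "compact A" "A \<noteq> {}" "hutchinson N f A = A"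
    using assms(2) by (auto simp: attractor_def hyperspace_def)
  have "continuous_on A (word_map f \<iota> k)"
    by (meson UNIV_I continuous_on_subset homeomorphism_cont1 subsetI
        word_map_homeomorphism[OF assms(1,4)])
  then have "closed (word_map f \<iota> k ` A)"
    using A(1) by (intro compact_imp_closed compact_continuous_image)
  moreover have "\<exists>y\<in>word_map f \<iota> k ` A. dist y (coding_map N f A \<iota>) < e" if "0 < e" for e
  proof -
    from word_map_images_shrink[OF assms that]
    obtain n where n: "word_map f \<iota> i ` A \<subseteq> ball (coding_map N f A \<iota>) e" if "n \<le> i" for i
      unfolding eventually_sequentially by blast
    obtain a where a: "a \<in> A"
      using A(2) by blast
    \<comment> \<open>The index \<open>max n k\<close> is late enough for the ball, and by
      monotonicity the point still lies in the image at stage \<open>k\<close>.\<close>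
    have "word_map f \<iota> (max n k) a \<in> word_map f \<iota> k ` A"
      using word_map_image_antimono[OF A(3) assms(4), of k "max n k"] a by auto
    moreover have "word_map f \<iota> (max n k) a \<in> ball (coding_map N f A \<iota>) e"
      using n[of "max n k"] a by auto
    ultimately show ?thesis
      by (auto simp: dist_commute)
  qed
  ultimately show ?thesis
    using closed_approachable by blast
qed

lemma coding_map_of_address:
  assumes "ifs N f" "attractor N f A" "point_fibred N f A" "\<iota> \<in> inf_words N"
    and "\<And>k. p \<in> word_map f \<iota> k ` A"
  shows "coding_map N f A \<iota> = p"
proof (rule dist_eq_0_iff[THEN iffD1], rule ccontr)
  assume "dist (coding_map N f A \<iota>) p \<noteq> 0"
  then have "0 < dist (coding_map N f A \<iota>) p" by simp
  \<comment> \<open>The radius is the distance to \<open>p\<close> itself: the ball is open, so it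
    misses \<open>p\<close>, although \<open>p\<close> lies in every image.\<close>
  from word_map_images_shrink[OF assms(1-4) this]
  obtain k where "word_map f \<iota> k ` A \<subseteq> ball (coding_map N f A \<iota>) (dist (coding_map N f A \<iota>) p)"
    by (auto simp: eventually_sequentially)
  with assms(5)[of k] show False by auto
qed

theorem theorem4p2:
  fixes N :: nat
    and f :: "nat \<Rightarrow> 'a::complete_space \<Rightarrow> 'a"
    and A :: "'a set"
    and \<theta> :: "nat \<Rightarrow> nat"
  assumes "ifs N f"
    and "attractor N f A"
    and "point_fibred N f A"
    and "\<theta> \<in> inf_words N"
    and "disjunctive N \<theta>"
  shows "coding_map N f A \<theta> \<in> interior A \<longleftrightarrow> interior A \<noteq> {}"
proof
  assume "interior A \<noteq> {}"
  then obtain p where p: "p \<in> interior A" by blast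
  then obtain e where e: "0 < e" "ball p e \<subseteq> interior A"
    using open_contains_ball open_interior by blast
  have A: "hutchinson N f A = A"
    using assms(2) by (simp add: attractor_def)
  obtain \<sigma> where \<sigma>: "\<sigma> \<in> inf_words N" "\<And>k. p \<in> word_map f \<sigma> k ` A"
    using exists_address[OF A] p interior_subset by blast
  have "coding_map N f A \<sigma> = p"
    by (rule coding_map_of_address[OF assms(1-3) \<sigma>])
  with word_map_images_shrink[OF assms(1-3) \<sigma>(1) e(1)]
  obtain k where k: "word_map f \<sigma> k ` A \<subseteq> interior A"
    using e(2) by (force simp: eventually_sequentially)
  have "map \<sigma> [0..<k] \<in> lists {1..N}"
    using \<sigma>(1) by (auto simp: inf_words_def)
  with assms(5) have "\<exists>m. map \<theta> [m..<m + length (map \<sigma> [0..<k])] = map \<sigma> [0..<k]"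
    unfolding disjunctive_def by (rule bspec)
  then obtain m where m: "map \<theta> [m..<m + k] = map \<sigma> [0..<k]"
    by auto
  have "\<theta> (m + i) = \<sigma> i" if "i < k" for i
    using arg_cong[OF m, of "\<lambda>w. w ! i"] that by simp
  \<comment> \<open>The shifted \<theta> agrees with \<sigma> only on the first \<open>k\<close>
    letters, but \<open>word_map\<close> at stage \<open>k\<close> reads no others.\<close>
  then have "word_map f \<theta> (m + k) ` A = word_map f \<theta> m ` word_map f \<sigma> k ` A"
    using word_map_cong[of k "\<lambda>i. \<theta> (m + i)" \<sigma> f] by (simp add: word_map_add image_comp)
  with coding_map_in_word_map_image[OF assms(1-4), of "m + k"]
  have "coding_map N f A \<theta> \<in> word_map f \<theta> m ` interior A"
    using k by auto
  moreover have "open (word_map f \<theta> m ` interior A)"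
    using word_map_homeomorphism[OF assms(1,4), of m]
      homeomorphism_imp_open_map[of UNIV UNIV "word_map f \<theta> m" _ "interior A"]
    by auto
  moreover have "word_map f \<theta> m ` interior A \<subseteq> A"
    using word_map_image_subset[OF A assms(4), of m] interior_subset[of A] by blast
  ultimately show "coding_map N f A \<theta> \<in> interior A"
    by (intro interiorI)
qed auto

end
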